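(* Let $f$ satisfy (f1) and suppose $f_0=0$ and $f_\infty=0$. Then there exists $\lambda_*^+>0$ such that for every $\lambda\in(\lambda_*^+,+\infty)$ problem (MO) has two solutions $u_1^+,u_2^+$ which are positive and strictly concave in $(0,1)$. Similarly, there exists $\lambda_*^->0$ such that for every $\lambda\in(\lambda_*^-,+\infty)$ problem (MO) has two solutions $u_1^-,u_2^-$ which are negative and strictly convex in $(0,1)$.
   Context: Let $N\ge 1$ be an integer and $f:\mathbb{R}\to\mathbb{R}$ continuous. For $\lambda\ge 0$, problem (MO) is: find $u\in C^2[0,1]$ with $\left((u'(r))^N\right)'=\lambda^N N r^{N-1} f(-u(r))$ for $0<r<1$ and $u'(0)=u(1)=0$. Condition (f1): $f\in C(\mathbb{R},\mathbb{R})$ and $f(s)s^N>0$ for all $s\neq0$. The quantities $f_0,f_\infty\in[0,+\infty]$ are defined by $f_0^N=\lim_{s\to0} f(s)/s^N$ and $f_\infty^N=\lim_{|s|\to+\infty} f(s)/s^N$ (limits assumed to exist in $[0,+\infty]$). *)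

theory Defs
  imports "HOL-Analysis.Analysis"
begin

definition strictly_convex_on :: "real set \<Rightarrow> (real \<Rightarrow> real) \<Rightarrow> bool" where
  "strictly_convex_on S g \<longleftrightarrow> convex S \<and>
     (\<forall>x\<in>S. \<forall>y\<in>S. x \<noteq> y \<longrightarrow> (\<forall>t. 0 < t \<and> t < 1 \<longrightarrow>
        g (t * x + (1 - t) * y) < t * g x + (1 - t) * g y))"

definition strictly_concave_on :: "real set \<Rightarrow> (real \<Rightarrow> real) \<Rightarrow> bool" where
  "strictly_concave_on S g \<longleftrightarrow> strictly_convex_on S (\<lambda>x. - g x)"

definition MO_solution :: "nat \<Rightarrow> (real \<Rightarrow> real) \<Rightarrow> real \<Rightarrow> (real \<Rightarrow> real) \<Rightarrow> bool" where
  "MO_solution N f lam u \<longleftrightarrow>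
     (\<exists>u' u''.
        (\<forall>r\<in>{0..1}. (u has_real_derivative u' r) (at r within {0..1})) \<and>
        (\<forall>r\<in>{0..1}. (u' has_real_derivative u'' r) (at r within {0..1})) \<and>
        continuous_on {0..1} u'' \<and>
        (\<forall>r\<in>{0<..<1}. ((\<lambda>t. (u' t) ^ N) has_real_derivative
            lam ^ N * real N * r ^ (N - 1) * f (- u r)) (at r)) \<and>
        u' 0 = 0 \<and> u 1 = 0)"

end

theory Submission
  imports Defs "HOL-Complex_Analysis.Great_Picard"
begin

text \<open>
  Writing \<open>u = \<sigma> v\<close> with \<open>\<sigma> = \<plusminus>1\<close> and \<open>v > 0\<close>, the problem becomes
  \<open>v r = a - \<lambda> \<integral>\<^sub>0\<^sup>r (\<integral>\<^sub>0\<^sup>s N t\<^sup>N\<^sup>-\<^sup>1 G (v t) dt)\<^sup>1\<^sup>/\<^sup>N ds\<close> with \<open>v 1 = 0\<close>, where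
  \<open>G s = (-\<sigma>)\<^sup>N f (-\<sigma> s)\<close>, and one shoots in the height \<open>a = v 0\<close>.
  As \<open>G\<close> is only continuous, the initial value problem need not have a unique solution. Delaying
  the argument of \<open>G (v t)\<close> by \<open>d > 0\<close> restores uniqueness and continuous dependence on \<open>a\<close>.
  Since \<open>G s / s\<^sup>N\<close> tends to 0 at 0 and at infinity, \<open>v 1 > 0\<close> for some small and some large \<open>a\<close>;
  concavity of \<open>v\<close> forces \<open>v 1 < 0\<close> for \<open>a = 1\<close> and \<open>\<lambda>\<close> large. All three estimates are
  uniform in \<open>d\<close>, so the intermediate value theorem gives one delayed solution below and one
  above height 1, and the Arzela-Ascoli theorem lets \<open>d\<close> tend to 0.
\<close>

section \<open>The radial integral operators: continuity and differentiation\<close>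

text \<open>
  With inner and outer integral rescaled to \<open>[0,1]\<close>, the double integral above is
  \<open>radial_drop N w r\<close> for \<open>w t = G (v t)\<close>; its derivative is
  \<open>(\<integral>\<^sub>0\<^sup>r N t\<^sup>N\<^sup>-\<^sup>1 w t dt)\<^sup>1\<^sup>/\<^sup>N = r (radial_mean N w r)\<^sup>1\<^sup>/\<^sup>N\<close>. Being defined on the whole
  real line, these forms need no one-sided derivatives at 0 and 1.
\<close>

definition radial_mean :: "nat \<Rightarrow> (real \<Rightarrow> real) \<Rightarrow> real \<Rightarrow> real" where
  "radial_mean N w t = real N * integral {0..1} (\<lambda>s. s ^ (N - 1) * w (t * s))"

definition radial_drop :: "nat \<Rightarrow> (real \<Rightarrow> real) \<Rightarrow> real \<Rightarrow> real" where
  "radial_drop N w r = r ^ 2 * integral {0..1} (\<lambda>s. s * root N (radial_mean N w (r * s)))"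

text \<open>Substituting \<open>x = r * s\<close> turns the function into \<open>H r - H 0\<close>
  for an antiderivative \<open>H\<close> of \<open>h\<close>. Scaling to \<open>{0..1}\<close> keeps
  this valid for either sign of \<open>r\<close>, so the derivative at 0 is two-sided.\<close>

lemma has_derivative_scaled_integral:
  fixes h :: "real \<Rightarrow> real"
  assumes "continuous_on UNIV h"
  shows "((\<lambda>r. r * integral {0..1} (\<lambda>s. h (r * s))) has_real_derivative h r) (at r)"
proof -
  define R where "R = \<bar>r\<bar> + 1"
  have "continuous_on {-R..R} h"
    using assms continuous_on_subset by blast
  then obtain H where H: "\<And>x. x \<in> {-R..R} \<Longrightarrow> (H has_vector_derivative h x) (at x within {-R..R})"
    using antiderivative_continuous by blast
  have H': "(H has_real_derivative h x) (at x)" if "x \<in> {-R<..<R}" for x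
    using H[of x] that at_within_Icc_at[of "-R" x R]
    by (auto simp: has_real_derivative_iff_has_vector_derivative)
  have eq: "x * integral {0..1} (\<lambda>s. h (x * s)) = H x - H 0" if x: "x \<in> {-R<..<R}" for x
  proof -
    have "((\<lambda>s. h (x * s) * x) has_integral (H (x * 1) - H (x * 0))) {0..1}"
    proof (rule fundamental_theorem_of_calculus)
      fix s :: real assume s: "s \<in> {0..1}"
      have "\<bar>x * s\<bar> \<le> \<bar>x\<bar> * 1"
        unfolding abs_mult using s by (intro mult_left_mono) auto
      then have "x * s \<in> {-R<..<R}" using x by auto
      then have "((\<lambda>s. H (x * s)) has_real_derivative h (x * s) * x) (at s)"
        using DERIV_chain2[OF H', of "\<lambda>s. x * s" s x] by (auto intro!: derivative_eq_intros)
      then show "((\<lambda>s. H (x * s)) has_vector_derivative h (x * s) * x) (at s within {0..1})"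
        using has_real_derivative_iff_has_vector_derivative has_vector_derivative_at_within by blast
    qed simp
    from integral_unique[OF this] show ?thesis by (simp add: mult.commute)
  qed
  have r: "r \<in> {-R<..<R}" by (auto simp: R_def)
  have "((\<lambda>x. H x - H 0) has_real_derivative h r) (at r)"
    using H'[OF r] by (auto intro!: derivative_eq_intros)
  then show ?thesis
    by (rule has_field_derivative_transform_within_open[where S = "{-R<..<R}"])
       (use r eq in auto)
qed

text \<open>With the integration range fixed, this is continuity of a parameter integral. The
  parameter \<open>a\<close> will be the shooting height.\<close>

lemma continuous_on_radial_mean_param:
  fixes \<phi> :: "'a::topological_space \<Rightarrow> real \<Rightarrow> real"
  assumes "continuous_on UNIV (\<lambda>(a, t). \<phi> a t)"
  shows "continuous_on UNIV (\<lambda>(a, t). radial_mean N (\<phi> a) t)"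
proof -
  have c: "continuous_on UNIV (\<lambda>((a, t), s). s ^ (N - 1) * \<phi> a (t * s))"
  proof -
    have "continuous_on UNIV (\<lambda>x::('a \<times> real) \<times> real. (\<lambda>(a, t). \<phi> a t) (fst (fst x), snd (fst x) * snd x))"
      by (rule continuous_on_compose2[OF assms]) (auto intro!: continuous_intros)
    then show ?thesis
      by (auto simp: case_prod_unfold intro!: continuous_intros)
  qed
  have "continuous_on UNIV (\<lambda>x. integral (cbox 0 1) (\<lambda>s. s ^ (N - 1) * \<phi> (fst x) (snd x * s)))"
    by (rule integral_continuous_on_param)
       (use c continuous_on_subset in \<open>auto simp: case_prod_unfold\<close>)
  then show ?thesis
    by (auto simp: radial_mean_def case_prod_unfold intro!: continuous_intros)
qed

lemma continuous_on_radial_drop_param: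
  fixes \<phi> :: "'a::topological_space \<Rightarrow> real \<Rightarrow> real"
  assumes "continuous_on UNIV (\<lambda>(a, t). \<phi> a t)"
  shows "continuous_on UNIV (\<lambda>(a, r). radial_drop N (\<phi> a) r)"
proof -
  have c: "continuous_on UNIV (\<lambda>((a, t), s). s * root N (radial_mean N (\<phi> a) (t * s)))"
  proof -
    have "continuous_on UNIV (\<lambda>x::('a \<times> real) \<times> real.
        (\<lambda>(a, t). radial_mean N (\<phi> a) t) (fst (fst x), snd (fst x) * snd x))"
      by (rule continuous_on_compose2[OF continuous_on_radial_mean_param[OF assms]])
         (auto intro!: continuous_intros)
    then show ?thesis
      by (auto simp: case_prod_unfold intro!: continuous_intros)
  qed
  have "continuous_on UNIV (\<lambda>x. integral (cbox 0 1) (\<lambda>s. s * root N (radial_mean N (\<phi> (fst x)) (snd x * s))))"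
    by (rule integral_continuous_on_param)
       (use c continuous_on_subset in \<open>auto simp: case_prod_unfold\<close>)
  then show ?thesis
    by (auto simp: radial_drop_def case_prod_unfold intro!: continuous_intros)
qed

lemma continuous_on_radial_mean:
  assumes "continuous_on UNIV w"
  shows "continuous_on UNIV (radial_mean N w)"
proof -
  \<comment> \<open>A dummy parameter reduces the claim to the joint version.\<close>
  have "continuous_on UNIV (\<lambda>(a::real, t). w t)"
    by (auto simp: case_prod_unfold intro!: continuous_intros continuous_on_compose2[OF assms])
  then have "continuous_on UNIV (\<lambda>(a::real, t). radial_mean N w t)"
    by (rule continuous_on_radial_mean_param)
  from continuous_on_compose2[OF this, of UNIV "\<lambda>t. (0, t)"] show ?thesis
    by (simp add: continuous_intros)
qed

text \<open>Moving the factor \<open>t ^ (N - 1)\<close> under the integral produces the scaled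
  integral of \<open>real N * s ^ (N - 1) * w s\<close>.\<close>

lemma DERIV_power_radial_mean:
  assumes "continuous_on UNIV w" "N \<ge> 1"
  shows "((\<lambda>t. t ^ N * radial_mean N w t) has_real_derivative real N * t ^ (N - 1) * w t) (at t)"
proof -
  have "continuous_on UNIV (\<lambda>s. real N * s ^ (N - 1) * w s)"
    using assms by (intro continuous_intros)
  note D = has_derivative_scaled_integral[OF this]
  have "x ^ N * radial_mean N w x = x * integral {0..1} (\<lambda>s. real N * (x * s) ^ (N - 1) * w (x * s))" for x
  proof -
    have "integral {0..1} (\<lambda>s. real N * (x * s) ^ (N - 1) * w (x * s)) =
        integral {0..1} (\<lambda>s. (real N * x ^ (N - 1)) * (s ^ (N - 1) * w (x * s)))"
      by (simp add: power_mult_distrib mult_ac)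
    also have "\<dots> = real N * x ^ (N - 1) * integral {0..1} (\<lambda>s. s ^ (N - 1) * w (x * s))"
      by simp
    finally show ?thesis
      using assms(2) by (simp add: radial_mean_def power_eq_if)
  qed
  then show ?thesis using D[of t] by simp
qed

lemma DERIV_radial_drop:
  assumes "continuous_on UNIV w"
  shows "(radial_drop N w has_real_derivative t * root N (radial_mean N w t)) (at t)"
proof -
  have "continuous_on UNIV (\<lambda>s. s * root N (radial_mean N w s))"
    by (intro continuous_intros continuous_on_radial_mean assms)
  note D = has_derivative_scaled_integral[OF this]
  have "radial_drop N w x = x * integral {0..1} (\<lambda>s. (x * s) * root N (radial_mean N w (x * s)))" for x
    by (simp add: radial_drop_def power2_eq_square mult.assoc)
  then have "radial_drop N w = (\<lambda>x. x * integral {0..1} (\<lambda>s. (x * s) * root N (radial_mean N w (x * s))))"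
    by (rule ext)
  then show ?thesis using D[of t] by simp
qed

section \<open>Locality, comparison and convexity of the radial drop\<close>

lemma radial_mean_cong:
  assumes "t \<ge> 0" "\<And>s. 0 \<le> s \<Longrightarrow> s \<le> t \<Longrightarrow> w s = w' s"
  shows "radial_mean N w t = radial_mean N w' t"
proof -
  have "w (t * s) = w' (t * s)" if "s \<in> {0..1}" for s
    using assms that by (auto intro!: assms mult_left_le)
  then show ?thesis
    unfolding radial_mean_def by (auto intro!: integral_cong)
qed

text \<open>The operator is causal: only the source on \<open>[0, r]\<close> enters. This lets the
  delayed equation be solved step by step.\<close>

lemma radial_drop_cong:
  assumes "r \<ge> 0" "\<And>s. 0 \<le> s \<Longrightarrow> s \<le> r \<Longrightarrow> w s = w' s"
  shows "radial_drop N w r = radial_drop N w' r"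
proof -
  have "radial_mean N w (r * s) = radial_mean N w' (r * s)" if "s \<in> {0..1}" for s
  proof (rule radial_mean_cong)
    have "r * s \<le> r" using assms that by (auto intro!: mult_left_le)
    then show "w x = w' x" if "0 \<le> x" "x \<le> r * s" for x
      using that assms(2) by auto
  qed (use assms that in auto)
  then show ?thesis
    unfolding radial_drop_def by (auto intro!: integral_cong)
qed

lemma has_integral_power_weight:
  assumes "N \<ge> 1"
  shows "((\<lambda>s::real. real N * s ^ (N - 1)) has_integral 1) {0..1}"
proof -
  have "((\<lambda>s::real. real N * s ^ (N - 1)) has_integral (1 ^ N - 0 ^ N)) {0..1}"
    by (rule fundamental_theorem_of_calculus)
       (auto intro!: derivative_eq_intros simp flip: has_real_derivative_iff_has_vector_derivative)
  then show ?thesis using assms by (simp add: power_0_left)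
qed

lemma radial_mean_integrable:
  assumes "continuous_on UNIV w"
  shows "(\<lambda>s. s ^ k * w (t * s)) integrable_on {0..1::real}"
  by (rule integrable_continuous_interval)
     (auto intro!: continuous_intros continuous_on_compose2[OF assms])

lemma radial_mean_mono:
  assumes "continuous_on UNIV w" "continuous_on UNIV w'" "t \<ge> 0"
    and "\<And>s. 0 \<le> s \<Longrightarrow> s \<le> t \<Longrightarrow> w s \<le> w' s"
  shows "radial_mean N w t \<le> radial_mean N w' t"
  unfolding radial_mean_def
proof (intro mult_left_mono integral_le radial_mean_integrable assms(1,2))
  fix s :: real assume "s \<in> {0..1}"
  then have "0 \<le> t * s" "t * s \<le> t" using assms by (auto intro: mult_left_le)
  then show "w (t * s) \<le> w' (t * s)" using assms by auto
qed auto

text \<open>The weight \<open>real N * s ^ (N - 1)\<close> has mass 1 on \<open>{0..1}\<close>, so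
  \<open>radial_mean\<close> is a true average and inherits pointwise bounds.\<close>

lemma radial_mean_const:
  assumes "N \<ge> 1"
  shows "radial_mean N (\<lambda>_. c) t = c"
proof -
  have "((\<lambda>s. real N * s ^ (N - 1) * c) has_integral 1 * c) {0..1}"
    by (intro has_integral_mult_left has_integral_power_weight assms)
  from integral_unique[OF this] show ?thesis
    by (simp add: radial_mean_def mult.assoc)
qed

lemma radial_mean_le:
  assumes "continuous_on UNIV w" "N \<ge> 1" "t \<ge> 0" "\<And>s. 0 \<le> s \<Longrightarrow> s \<le> t \<Longrightarrow> w s \<le> c"
  shows "radial_mean N w t \<le> c"
  using radial_mean_mono[of w "\<lambda>_. c" t N] assms by (simp add: radial_mean_const)

lemma radial_mean_ge:
  assumes "continuous_on UNIV w" "N \<ge> 1" "t \<ge> 0" "\<And>s. 0 \<le> s \<Longrightarrow> s \<le> t \<Longrightarrow> c \<le> w s"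
  shows "c \<le> radial_mean N w t"
  using radial_mean_mono[of "\<lambda>_. c" w t N] assms by (simp add: radial_mean_const)

lemma radial_drop_at_0 [simp]: "radial_drop N w 0 = 0"
  by (simp add: radial_drop_def)

lemma radial_mean_at_0: "N \<ge> 1 \<Longrightarrow> radial_mean N w 0 = w 0"
  using radial_mean_const[of N "w 0" 0] by (simp add: radial_mean_def)

lemma radial_slope_eq:
  assumes "N \<ge> 1" "t \<ge> 0"
  shows "t * root N (radial_mean N w t) = root N (t ^ N * radial_mean N w t)"
  using assms by (simp add: real_root_mult real_root_power_cancel)

text \<open>The \<open>N\<close>-th power of the slope has derivative
  \<open>real N * t ^ (N - 1) * w t\<close>, which is nonnegative for \<open>t \<ge> 0\<close>. So
  the drop is convex there, which is the concavity of the profiles.\<close>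

lemma radial_slope_mono:
  assumes "continuous_on UNIV w" "N \<ge> 1" "\<And>s. w s \<ge> 0" "0 \<le> x" "x \<le> y"
  shows "x * root N (radial_mean N w x) \<le> y * root N (radial_mean N w y)"
proof -
  have "x ^ N * radial_mean N w x \<le> y ^ N * radial_mean N w y"
    by (rule DERIV_nonneg_imp_nondecreasing)
       (use assms in \<open>auto intro!: exI DERIV_power_radial_mean\<close>)
  then show ?thesis
    using assms by (simp add: radial_slope_eq)
qed

text \<open>By the mean value theorem, since the slope lies between 0 and \<open>root N c\<close> on
  \<open>[0, 1]\<close>. The Lipschitz constant depends on the source only through \<open>c\<close>,
  as equicontinuity will require.\<close>

lemma radial_drop_mono_lipschitz:
  assumes "continuous_on UNIV w" "N \<ge> 1" "\<And>s. w s \<ge> 0"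
    "\<And>s. 0 \<le> s \<Longrightarrow> s \<le> 1 \<Longrightarrow> w s \<le> c" "0 \<le> x" "x \<le> y" "y \<le> 1"
  shows "radial_drop N w x \<le> radial_drop N w y"
    and "radial_drop N w y - radial_drop N w x \<le> root N c * (y - x)"
proof -
  have "radial_drop N w x \<le> radial_drop N w y \<and>
      radial_drop N w y - radial_drop N w x \<le> root N c * (y - x)"
  proof (cases "x = y")
    case False
    then obtain z where z: "x < z" "z < y"
      "radial_drop N w y - radial_drop N w x = (y - x) * (z * root N (radial_mean N w z))"
      using MVT2[of x y "radial_drop N w"] DERIV_radial_drop[OF assms(1)] assms by force
    have m: "0 \<le> radial_mean N w z" "radial_mean N w z \<le> c"
      using radial_mean_ge[of w N z 0] radial_mean_le[of w N z c] z assms by auto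
    have "z * root N (radial_mean N w z) \<le> 1 * root N c"
      using z m assms by (intro mult_mono) auto
    moreover have "0 \<le> z * root N (radial_mean N w z)"
      using m z assms by simp
    ultimately have "0 \<le> (y - x) * (z * root N (radial_mean N w z))"
      "(y - x) * (z * root N (radial_mean N w z)) \<le> (y - x) * root N c"
      using assms by (simp, intro mult_left_mono) auto
    then show ?thesis using z by (simp add: mult.commute)
  qed simp
  then show "radial_drop N w x \<le> radial_drop N w y"
    "radial_drop N w y - radial_drop N w x \<le> root N c * (y - x)" by auto
qed

text \<open>The bound is the drop of the constant source \<open>c\<close>. Bound minus drop is
  nondecreasing, because the slopes are ordered.\<close>

lemma radial_drop_le:
  assumes "continuous_on UNIV w" "N \<ge> 1" "r \<ge> 0" "\<And>s. 0 \<le> s \<Longrightarrow> s \<le> r \<Longrightarrow> w s \<le> c"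
  shows "radial_drop N w r \<le> root N c * r\<^sup>2 / 2"
proof -
  have "root N c * 0\<^sup>2 / 2 - radial_drop N w 0 \<le> root N c * r\<^sup>2 / 2 - radial_drop N w r"
  proof (rule DERIV_nonneg_imp_nondecreasing[OF assms(3)])
    fix x assume x: "0 \<le> x" "x \<le> r"
    have "((\<lambda>r. root N c * r\<^sup>2 / 2 - radial_drop N w r) has_real_derivative
        root N c * x - x * root N (radial_mean N w x)) (at x)"
      using DERIV_radial_drop[OF assms(1)] by (auto intro!: derivative_eq_intros)
    moreover have "radial_mean N w x \<le> c"
      using x assms by (intro radial_mean_le) auto
    then have "x * root N (radial_mean N w x) \<le> x * root N c"
      using x assms by (intro mult_left_mono) auto
    ultimately show "\<exists>y. ((\<lambda>r. root N c * r\<^sup>2 / 2 - radial_drop N w r) has_real_derivative y) (at x) \<and> 0 \<le> y"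
      by (intro exI conjI) (auto simp: mult.commute)
  qed
  then show ?thesis by simp
qed

lemma radial_drop_ge:
  assumes "continuous_on UNIV w" "N \<ge> 1" "r \<ge> 0" "\<And>s. 0 \<le> s \<Longrightarrow> s \<le> r \<Longrightarrow> c \<le> w s"
  shows "root N c * r\<^sup>2 / 2 \<le> radial_drop N w r"
proof -
  have "radial_drop N w 0 - root N c * 0\<^sup>2 / 2 \<le> radial_drop N w r - root N c * r\<^sup>2 / 2"
  proof (rule DERIV_nonneg_imp_nondecreasing[OF assms(3)])
    fix x assume x: "0 \<le> x" "x \<le> r"
    have "((\<lambda>r. radial_drop N w r - root N c * r\<^sup>2 / 2) has_real_derivative
        x * root N (radial_mean N w x) - root N c * x) (at x)"
      using DERIV_radial_drop[OF assms(1)] by (auto intro!: derivative_eq_intros)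
    moreover have "c \<le> radial_mean N w x"
      using x assms by (intro radial_mean_ge) auto
    then have "x * root N c \<le> x * root N (radial_mean N w x)"
      using x assms by (intro mult_left_mono) auto
    ultimately show "\<exists>y. ((\<lambda>r. radial_drop N w r - root N c * r\<^sup>2 / 2) has_real_derivative y) (at x) \<and> 0 \<le> y"
      by (intro exI conjI) (auto simp: mult.commute)
  qed
  then show ?thesis by simp
qed

text \<open>A convex function vanishing at 0 lies below its chord: its mean slope on
  \<open>[0, r]\<close> is at most that on \<open>[r, 1]\<close>.\<close>

lemma radial_drop_starlike:
  assumes "continuous_on UNIV w" "N \<ge> 1" "\<And>s. w s \<ge> 0" "0 \<le> r" "r \<le> 1"
  shows "radial_drop N w r \<le> r * radial_drop N w 1"
proof (cases "r = 0 \<or> r = 1")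
  case False
  then have r: "0 < r" "r < 1" using assms by auto
  obtain x where x: "0 < x" "x < r" "radial_drop N w r = r * (x * root N (radial_mean N w x))"
    using MVT2[of 0 r "radial_drop N w"] DERIV_radial_drop[OF assms(1)] r by force
  obtain y where y: "r < y" "y < 1"
    "radial_drop N w 1 - radial_drop N w r = (1 - r) * (y * root N (radial_mean N w y))"
    using MVT2[of r 1 "radial_drop N w"] DERIV_radial_drop[OF assms(1)] r by force
  have "x * root N (radial_mean N w x) \<le> y * root N (radial_mean N w y)"
    using x y assms by (intro radial_slope_mono) auto
  \<comment> \<open>The factor \<open>r * (1 - r)\<close> clears the denominators of both mean
    slopes.\<close>
  then have "(r * (1 - r)) * (x * root N (radial_mean N w x)) \<le> (r * (1 - r)) * (y * root N (radial_mean N w y))"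
    using r by (intro mult_left_mono) auto
  then have "(1 - r) * radial_drop N w r \<le> r * (radial_drop N w 1 - radial_drop N w r)"
    using x y by (simp add: mult_ac)
  then show ?thesis by (simp add: algebra_simps)
qed auto

section \<open>Passage to the limit in the operators\<close>

lemma tendsto_radial_mean:
  assumes "\<And>n. continuous_on UNIV (w n)" "\<And>n s. 0 \<le> s \<Longrightarrow> s \<le> 1 \<Longrightarrow> \<bar>w n s\<bar> \<le> c"
    and "\<And>s. 0 \<le> s \<Longrightarrow> s \<le> 1 \<Longrightarrow> (\<lambda>n. w n s) \<longlonglongrightarrow> w' s" "0 \<le> t" "t \<le> 1"
  shows "(\<lambda>n. radial_mean N (w n) t) \<longlonglongrightarrow> radial_mean N w' t"
proof -
  have ts: "0 \<le> t * s" "t * s \<le> 1" if "s \<in> {0..1}" for s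
    using that assms mult_le_one[of t s] by auto
  have "(\<lambda>n. integral {0..1} (\<lambda>s. s ^ (N - 1) * w n (t * s))) \<longlonglongrightarrow>
      integral {0..1} (\<lambda>s. s ^ (N - 1) * w' (t * s))"
  proof (rule dominated_convergence(2)[where h = "\<lambda>_. c"])
    show "norm (s ^ (N - 1) * w n (t * s)) \<le> c" if "s \<in> {0..1}" for n s
    proof -
      have "s ^ (N - 1) * \<bar>w n (t * s)\<bar> \<le> 1 * c"
        using that ts[OF that] by (intro mult_mono assms power_le_one) auto
      then show ?thesis using that by (simp add: abs_mult)
    qed
    show "(\<lambda>n. s ^ (N - 1) * w n (t * s)) \<longlonglongrightarrow> s ^ (N - 1) * w' (t * s)" if "s \<in> {0..1}" for s
      using ts[OF that] by (intro tendsto_intros assms)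
  qed (auto intro: radial_mean_integrable assms)
  then show ?thesis
    unfolding radial_mean_def by (intro tendsto_intros)
qed

text \<open>Dominated convergence is applied to the inner mean and then to the outer integral, where
  \<open>root N c\<close> is the majorant.\<close>

lemma tendsto_radial_drop:
  assumes "\<And>n. continuous_on UNIV (w n)" "N \<ge> 1"
    and "\<And>n s. w n s \<ge> 0" "\<And>n s. 0 \<le> s \<Longrightarrow> s \<le> 1 \<Longrightarrow> w n s \<le> c"
    and "\<And>s. 0 \<le> s \<Longrightarrow> s \<le> 1 \<Longrightarrow> (\<lambda>n. w n s) \<longlonglongrightarrow> w' s" "0 \<le> r" "r \<le> 1"
  shows "(\<lambda>n. radial_drop N (w n) r) \<longlonglongrightarrow> radial_drop N w' r"
proof -
  have rs: "0 \<le> r * s" "r * s \<le> 1" if "s \<in> {0..1}" for s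
    using that assms mult_le_one[of r s] by auto
  have "(\<lambda>n. integral {0..1} (\<lambda>s. s * root N (radial_mean N (w n) (r * s)))) \<longlonglongrightarrow>
      integral {0..1} (\<lambda>s. s * root N (radial_mean N w' (r * s)))"
  proof (rule dominated_convergence(2)[where h = "\<lambda>_. root N c"])
    show "norm (s * root N (radial_mean N (w n) (r * s))) \<le> root N c" if "s \<in> {0..1}" for n s
    proof -
      have m: "0 \<le> radial_mean N (w n) (r * s)" "radial_mean N (w n) (r * s) \<le> c"
        using rs[OF that] by (intro radial_mean_ge radial_mean_le assms; simp)+
      then have "s * root N (radial_mean N (w n) (r * s)) \<le> 1 * root N c"
        using that assms(2) by (intro mult_mono) auto
      then show ?thesis using that m assms(2) by (simp add: abs_mult)
    qed
    show "(\<lambda>n. s * root N (radial_mean N (w n) (r * s))) \<longlonglongrightarrow> s * root N (radial_mean N w' (r * s))"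
      if "s \<in> {0..1}" for s
      using rs[OF that] assms by (intro tendsto_intros tendsto_radial_mean[where c = c]) auto
    show "(\<lambda>s. s * root N (radial_mean N (w n) (r * s))) integrable_on {0..1}" for n
      by (intro integrable_continuous_interval continuous_intros
          continuous_on_compose2[OF continuous_on_radial_mean[OF assms(1)]]) auto
  qed auto
  then show ?thesis
    unfolding radial_drop_def by (intro tendsto_intros)
qed

section \<open>The delayed problem, solved by iteration\<close>

text \<open>The cut-off \<open>max 0\<close> holds the delayed argument at 0 while
  \<open>t \<le> d\<close>, and \<open>d = 0\<close> recovers the original integral equation. The
  equation is imposed on \<open>[0, 1]\<close> only; continuity on the whole line keeps the source
  continuous everywhere.\<close>

definition delayed_profile ::
  "nat \<Rightarrow> (real \<Rightarrow> real) \<Rightarrow> real \<Rightarrow> real \<Rightarrow> real \<Rightarrow> (real \<Rightarrow> real) \<Rightarrow> bool" where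
  "delayed_profile N G lam d a v \<longleftrightarrow> continuous_on UNIV v \<and>
     (\<forall>r\<in>{0..1}. v r = a - lam * radial_drop N (\<lambda>t. G (v (max 0 (t - d)))) r)"

text \<open>Iterating the delayed equation from the constant \<open>a\<close> settles at step \<open>k\<close> on \<open>[0, k d]\<close>.\<close>

primrec shoot :: "nat \<Rightarrow> (real \<Rightarrow> real) \<Rightarrow> real \<Rightarrow> real \<Rightarrow> nat \<Rightarrow> real \<Rightarrow> real \<Rightarrow> real" where
  "shoot N G lam d 0 a = (\<lambda>r. a)"
| "shoot N G lam d (Suc k) a =
     (\<lambda>r. a - lam * radial_drop N (\<lambda>t. G (shoot N G lam d k a (max 0 (t - d)))) r)"

lemma continuous_on_shoot:
  assumes "continuous_on UNIV G"
  shows "continuous_on UNIV (\<lambda>(a, r). shoot N G lam d k a r)"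
proof (induction k)
  case 0
  show ?case by (auto simp: case_prod_unfold intro!: continuous_intros)
next
  case (Suc k)
  have "continuous_on UNIV (\<lambda>x. (\<lambda>(a, r). shoot N G lam d k a r) (fst x, max 0 (snd x - d)))"
    by (rule continuous_on_compose2[OF Suc.IH]) (auto intro!: continuous_intros)
  then have "continuous_on UNIV (\<lambda>(a, t). G (shoot N G lam d k a (max 0 (t - d))))"
    by (auto simp: case_prod_unfold intro!: continuous_on_compose2[OF assms])
  from continuous_on_radial_drop_param[OF this, of N] show ?case
    by (auto simp: case_prod_unfold intro!: continuous_intros)
qed

text \<open>Induction on \<open>k\<close>: up to \<open>(k + 1) d\<close> the delayed source reads
  the iterates on \<open>[0, k d]\<close> only, where they already agree, and the operator is
  causal. For \<open>k = 0\<close> only \<open>r = 0\<close> remains, where the drop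
  vanishes.\<close>

lemma shoot_stable:
  assumes "d \<ge> 0" "0 \<le> r" "r \<le> real k * d"
  shows "shoot N G lam d (Suc k) a r = shoot N G lam d k a r"
  using assms(2,3)
proof (induction k arbitrary: r)
  case 0
  then show ?case by simp
next
  case (Suc k)
  have "radial_drop N (\<lambda>t. G (shoot N G lam d (Suc k) a (max 0 (t - d)))) r =
      radial_drop N (\<lambda>t. G (shoot N G lam d k a (max 0 (t - d)))) r"
  proof (rule radial_drop_cong)
    fix s assume s: "0 \<le> s" "s \<le> r"
    have "max 0 (s - d) \<le> real k * d"
      using s Suc.prems assms(1) by (auto simp: algebra_simps)
    then show "G (shoot N G lam d (Suc k) a (max 0 (s - d))) = G (shoot N G lam d k a (max 0 (s - d)))"
      using Suc.IH[of "max 0 (s - d)"] by (simp del: shoot.simps)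
  qed (use Suc.prems in auto)
  then show ?case
    by (subst (1 2) shoot.simps(2)) simp
qed

text \<open>Once \<open>k\<close> steps of length \<open>d\<close> cover \<open>[0, 1]\<close>, the
  iterate has settled on the whole interval. With \<open>k\<close> fixed it depends continuously on
  \<open>a\<close>.\<close>

lemma delayed_profile_shoot:
  assumes "continuous_on UNIV G" "d \<ge> 0" "1 \<le> real k * d"
  shows "delayed_profile N G lam d a (shoot N G lam d k a)"
proof -
  have "continuous_on UNIV (\<lambda>r. (\<lambda>(a, r). shoot N G lam d k a r) (a, r))"
    by (rule continuous_on_compose2[OF continuous_on_shoot[OF assms(1)]]) (auto intro!: continuous_intros)
  moreover have "shoot N G lam d k a r =
      a - lam * radial_drop N (\<lambda>t. G (shoot N G lam d k a (max 0 (t - d)))) r" if "r \<in> {0..1}" for r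
    using shoot_stable[of d r k N G lam a] that assms by auto
  ultimately show ?thesis by (auto simp: delayed_profile_def)
qed

section \<open>A criterion for strict convexity\<close>

text \<open>The mean value theorem on both sides of the intermediate point \<open>z\<close> gives
  slopes \<open>g' p < g' q\<close> with \<open>p < z < q\<close>; this compares the two chords
  meeting at \<open>z\<close>.\<close>

lemma strictly_convex_on_deriv:
  assumes D: "\<And>x. a < x \<Longrightarrow> x < b \<Longrightarrow> (g has_real_derivative g' x) (at x)"
    and mono: "\<And>x y. a < x \<Longrightarrow> x < y \<Longrightarrow> y < b \<Longrightarrow> g' x < g' y"
  shows "strictly_convex_on {a<..<b} g"
proof -
  have *: "g (t * x + (1 - t) * y) < t * g x + (1 - t) * g y"
    if xy: "a < x" "x < y" "y < b" and t: "0 < t" "t < 1" for x y t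
  proof -
    define z where "z = t * x + (1 - t) * y"
    have e: "z - x = (1 - t) * (y - x)" "y - z = t * (y - x)"
      by (auto simp: z_def algebra_simps)
    then have z: "x < z" "z < y"
      using xy t by (metis diff_gt_0_iff_gt mult_pos_pos)+
    obtain p where p: "x < p" "p < z" "g z - g x = (z - x) * g' p"
      using MVT2[of x z g g'] z xy D by auto
    obtain q where q: "z < q" "q < y" "g y - g z = (y - z) * g' q"
      using MVT2[of z y g g'] z xy D by auto
    have "0 < ((1 - t) * (t * (y - x))) * (g' q - g' p)"
      using mono[of p q] p q xy t by simp
    also have "\<dots> = (1 - t) * (g y - g z) - t * (g z - g x)"
      unfolding p q e by (simp add: algebra_simps)
    finally show ?thesis unfolding z_def[symmetric] by (simp add: algebra_simps)
  qed
  have "g (t * x + (1 - t) * y) < t * g x + (1 - t) * g y"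
    if "x \<in> {a<..<b}" "y \<in> {a<..<b}" "x \<noteq> y" "0 < t" "t < 1" for x y t
    using that *[of x y t] *[of y x "1 - t"] by (cases "x < y") (auto simp: add.commute)
  then show ?thesis
    unfolding strictly_convex_on_def by auto
qed

section \<open>Delayed profiles of a nonnegative source: the sign at the endpoint\<close>

text \<open>Extending \<open>G\<close> by 0 to the nonpositive half-line keeps the source
  nonnegative even along a profile that crosses zero before \<open>r = 1\<close>. For
  \<open>lam \<ge> 0\<close> every profile is thus nonincreasing and concave on
  \<open>[0, 1]\<close>.\<close>

locale positive_nonlinearity =
  fixes N :: nat and G :: "real \<Rightarrow> real"
  assumes N: "N \<ge> 1"
    and cont: "continuous_on UNIV G"
    and nonpos: "\<And>s. s \<le> 0 \<Longrightarrow> G s = 0"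
    and pos: "\<And>s. s > 0 \<Longrightarrow> G s > 0"
begin

lemma nonneg: "G s \<ge> 0"
  using nonpos[of s] pos[of s] by (cases "s \<le> 0") auto

lemma continuous_delayed:
  fixes v :: "real \<Rightarrow> real"
  assumes "continuous_on UNIV v"
  shows "continuous_on UNIV (\<lambda>t. G (v (max 0 (t - d))))"
  by (rule continuous_on_compose2[OF cont], rule continuous_on_compose2[OF assms])
     (auto intro!: continuous_intros)

lemma profile_le:
  assumes "delayed_profile N G lam d a v" "lam \<ge> 0" "0 \<le> r" "r \<le> 1"
  shows "v r \<le> a"
proof -
  have "root N 0 * r\<^sup>2 / 2 \<le> radial_drop N (\<lambda>t. G (v (max 0 (t - d)))) r"
    using assms by (intro radial_drop_ge continuous_delayed N nonneg) (auto simp: delayed_profile_def)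
  then have "0 \<le> lam * radial_drop N (\<lambda>t. G (v (max 0 (t - d)))) r"
    using assms by simp
  then show ?thesis using assms by (auto simp: delayed_profile_def)
qed

text \<open>The profile never exceeds its height \<open>a\<close>, and \<open>G\<close> vanishes
  where the profile is negative, so a bound of \<open>G\<close> on \<open>[0, a]\<close>
  suffices.\<close>

lemma profile_source_le:
  assumes "delayed_profile N G lam d a v" "lam \<ge> 0" "d \<ge> 0" "0 \<le> t" "t \<le> 1"
    and "\<And>s. 0 \<le> s \<Longrightarrow> s \<le> a \<Longrightarrow> G s \<le> c" "c \<ge> 0"
  shows "G (v (max 0 (t - d))) \<le> c"
proof -
  have "v (max 0 (t - d)) \<le> a"
    using assms by (intro profile_le[OF assms(1)]) auto
  then show ?thesis
    using assms nonpos[of "v (max 0 (t - d))"] by (cases "v (max 0 (t - d)) \<le> 0") auto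
qed

text \<open>The \<open>N\<close>-th root of the assumed bound is \<open>a / lam\<close>, so
  \<open>lam\<close> times the total drop is at most \<open>a / 2\<close>, whatever the
  delay.\<close>

lemma profile_end_pos:
  assumes "delayed_profile N G lam d a v" "lam > 0" "d \<ge> 0" "a > 0"
    and "\<And>s. 0 \<le> s \<Longrightarrow> s \<le> a \<Longrightarrow> G s \<le> (1 / lam) ^ N * a ^ N"
  shows "v 1 > 0"
proof -
  have "radial_drop N (\<lambda>t. G (v (max 0 (t - d)))) 1 \<le> root N ((1 / lam) ^ N * a ^ N) * 1\<^sup>2 / 2"
    using assms
    by (intro radial_drop_le continuous_delayed N profile_source_le[OF assms(1)]) (auto simp: delayed_profile_def)
  also have "\<dots> = a / lam / 2"
    using assms N by (simp add: real_root_mult real_root_power_cancel real_root_divide power_divide)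
  finally have "lam * radial_drop N (\<lambda>t. G (v (max 0 (t - d)))) 1 \<le> a / 2"
    using assms by (simp add: field_simps)
  then show ?thesis using assms by (auto simp: delayed_profile_def)
qed

text \<open>If \<open>v 1 \<ge> 0\<close>, concavity keeps \<open>v r \<ge> 1 - r\<close>. Then
  \<open>v \<ge> 1/2\<close> on \<open>[0, 1/2]\<close>, the source there is at least
  \<open>m\<close>, and the drop at \<open>1/2\<close> is at least \<open>root N m / 8\<close>. For
  \<open>lam > 4 / root N m\<close> this pushes \<open>v (1/2)\<close> below \<open>1/2\<close>, a
  contradiction.\<close>

lemma profile_end_neg:
  assumes "delayed_profile N G lam d 1 v" "d \<ge> 0"
    and "m > 0" "\<And>s. 1/2 \<le> s \<Longrightarrow> s \<le> 1 \<Longrightarrow> m \<le> G s" "lam > 4 / root N m"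
  shows "v 1 < 0"
proof (rule ccontr)
  assume "\<not> v 1 < 0"
  define w where "w = (\<lambda>t. G (v (max 0 (t - d))))"
  have rm: "root N m > 0" using assms N by simp
  have lam: "lam > 0" using assms(5) rm by (meson divide_pos_pos less_trans zero_less_numeral)
  have w: "continuous_on UNIV w" "\<And>s. w s \<ge> 0"
    using assms(1) by (auto simp: w_def delayed_profile_def intro: continuous_delayed nonneg)
  have v: "v r = 1 - lam * radial_drop N w r" if "0 \<le> r" "r \<le> 1" for r
    using assms(1) that by (auto simp: w_def delayed_profile_def)
  have lower: "v r \<ge> 1 - r" if "0 \<le> r" "r \<le> 1" for r
  proof -
    have "lam * radial_drop N w r \<le> lam * (r * radial_drop N w 1)"
      using that lam by (intro mult_left_mono radial_drop_starlike w N) auto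
    also have "\<dots> = r * (lam * radial_drop N w 1)" by simp
    also have "\<dots> \<le> r * 1"
      using \<open>\<not> v 1 < 0\<close> v[of 1] that by (intro mult_left_mono) auto
    finally show ?thesis using v[OF that] by simp
  qed
  have "root N m * (1/2)\<^sup>2 / 2 \<le> radial_drop N w (1/2)"
  proof (intro radial_drop_ge w N)
    fix s :: real assume s: "0 \<le> s" "s \<le> 1/2"
    then have "v (max 0 (s - d)) \<ge> 1/2" "v (max 0 (s - d)) \<le> 1"
      using lower[of "max 0 (s - d)"] profile_le[OF assms(1), of "max 0 (s - d)"] lam assms(2) by auto
    then show "m \<le> w s" unfolding w_def by (rule assms(4))
  qed simp
  then have "lam * (root N m / 8) \<le> lam * radial_drop N w (1/2)"
    using lam by (intro mult_left_mono) (auto simp: power2_eq_square)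
  also have "\<dots> \<le> 1/2" using lower[of "1/2"] v[of "1/2"] by simp
  finally show False using assms(5) rm by (simp add: field_simps)
qed

section \<open>Removing the delay and finding two profiles\<close>

text \<open>Bounded heights give one bound \<open>c\<close> for all sources, hence one Lipschitz
  constant \<open>L\<close> for all profiles. A uniform limit of a subsequence solves the equation
  without delay.\<close>

lemma profile_limit:
  assumes prof: "\<And>n. delayed_profile N G lam (d n) (a n) (v n)" and lam: "lam > 0"
    and d: "\<And>n. d n \<ge> 0" "d \<longlonglongrightarrow> 0" and a: "\<And>n. lo \<le> a n" "\<And>n. a n \<le> hi"
    and v1: "\<And>n. v n 1 = 0"
  obtains b u where "delayed_profile N G lam 0 b u" "u 1 = 0" "lo \<le> b" "b \<le> hi"
proof -
  define w where "w = (\<lambda>n t. G (v n (max 0 (t - d n))))"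
  have "compact (G ` {0..hi})"
    using cont by (intro compact_continuous_image) (auto intro: continuous_on_subset)
  then obtain M where M: "\<And>x. x \<in> G ` {0..hi} \<Longrightarrow> norm x \<le> M"
    using bounded_iff compact_imp_bounded by metis
  \<comment> \<open>If \<open>hi < 0\<close>, the set bounded by \<open>M\<close> is empty and
    \<open>M\<close> may be negative.\<close>
  define c where "c = max M 0"
  have c: "G s \<le> c" if "0 \<le> s" "s \<le> hi" for s
    using M[of "G s"] that nonneg[of s] by (auto simp: c_def)
  have w: "continuous_on UNIV (w n)" "w n s \<ge> 0" for n s
    using prof[of n] by (auto simp: w_def delayed_profile_def intro: continuous_delayed nonneg)
  have wc: "w n s \<le> c" if "0 \<le> s" "s \<le> 1" for n s
    unfolding w_def
    by (rule profile_source_le[OF prof]) (use that d lam c a order_trans[OF _ a(2)[of n]] in \<open>auto simp: c_def\<close>)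
  have v: "v n r = a n - lam * radial_drop N (w n) r" if "0 \<le> r" "r \<le> 1" for n r
    using prof[of n] that by (auto simp: w_def delayed_profile_def)
  define L where "L = lam * root N c"
  have L: "L \<ge> 0" using lam N by (simp add: L_def c_def)
  have lip0: "\<bar>v n x - v n y\<bar> \<le> L * (y - x)" if "0 \<le> x" "x \<le> y" "y \<le> 1" for n x y
  proof -
    have "radial_drop N (w n) x \<le> radial_drop N (w n) y"
      "radial_drop N (w n) y - radial_drop N (w n) x \<le> root N c * (y - x)"
      using radial_drop_mono_lipschitz[of "w n" N c x y] w wc N that by auto
    then have "0 \<le> lam * (radial_drop N (w n) y - radial_drop N (w n) x)"
      "lam * (radial_drop N (w n) y - radial_drop N (w n) x) \<le> lam * (root N c * (y - x))"
      using lam by (auto intro!: mult_left_mono)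
    then show ?thesis
      using v[of x n] v[of y n] that by (simp add: L_def algebra_simps)
  qed
  have lip: "\<bar>v n x - v n y\<bar> \<le> L * \<bar>x - y\<bar>" if "x \<in> {0..1}" "y \<in> {0..1}" for n x y
    using lip0[of x y n] lip0[of y x n] that by (cases "x \<le> y") (auto simp: abs_minus_commute)
  obtain g k where g: "continuous_on {0..1} g" and k: "strict_mono (k::nat \<Rightarrow> nat)"
    and lim: "\<And>e. 0 < e \<Longrightarrow> \<exists>K. \<forall>n x. n \<ge> K \<and> x \<in> {0..1} \<longrightarrow> norm (v (k n) x - g x) < e"
  proof (rule Arzela_Ascoli[of "{0..1::real}" v L])
    \<comment> \<open>The common zero at 1 anchors the Lipschitz bound.\<close>
    show "norm (v n x) \<le> L" if "x \<in> {0..1}" for n x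
    proof -
      have "L * (1 - x) \<le> L * 1" using that L by (intro mult_left_mono) auto
      then show ?thesis using lip0[of x 1 n] v1[of n] that by auto
    qed
    fix x e :: real assume x: "x \<in> {0..1}" "0 < e"
    show "\<exists>\<delta>>0. \<forall>n y. y \<in> {0..1} \<and> norm (x - y) < \<delta> \<longrightarrow> norm (v n x - v n y) < e"
    \<comment> \<open>Adding 1 covers the case \<open>L = 0\<close>.\<close>
    proof (intro exI[of _ "e / (L + 1)"] conjI allI impI)
      show "e / (L + 1) > 0" using x L by simp
      fix n y assume y: "y \<in> {0..1} \<and> norm (x - y) < e / (L + 1)"
      have "\<bar>v n x - v n y\<bar> \<le> (L + 1) * \<bar>x - y\<bar>"
        using lip[of x y n] x y by (simp add: algebra_simps)
      also have "\<dots> < e" using y L by (simp add: field_simps)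
      finally show "norm (v n x - v n y) < e" by simp
    qed
  qed auto
  have pw: "(\<lambda>n. v (k n) x) \<longlonglongrightarrow> g x" if "x \<in> {0..1}" for x
    unfolding LIMSEQ_iff using lim that by meson
  \<comment> \<open>The limit \<open>g\<close> is controlled on \<open>[0, 1]\<close> only; clamping
    extends it continuously to the real line.\<close>
  define u where "u = (\<lambda>t. g (max 0 (min 1 t)))"
  have u: "continuous_on UNIV u"
    unfolding u_def by (intro continuous_on_compose2[OF g] continuous_intros) auto
  have ug: "u x = g x" if "x \<in> {0..1}" for x
    using that by (auto simp: u_def)
  have dk: "(\<lambda>n. d (k n)) \<longlonglongrightarrow> 0"
    using LIMSEQ_subseq_LIMSEQ[OF d(2) k] by (simp add: o_def)
  have ww: "(\<lambda>n. w (k n) s) \<longlonglongrightarrow> G (u (max 0 (s - 0)))" if s: "0 \<le> s" "s \<le> 1" for s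
  proof -
    \<comment> \<open>The common Lipschitz constant bounds the effect of the delay by
      \<open>L * d (k n)\<close>.\<close>
    have "(\<lambda>n. v (k n) (max 0 (s - d (k n))) - v (k n) s) \<longlonglongrightarrow> 0"
    proof (rule Lim_null_comparison)
      have "norm (v (k n) (max 0 (s - d (k n))) - v (k n) s) \<le> L * d (k n)" for n
      proof -
        have "\<bar>max 0 (s - d (k n)) - s\<bar> \<le> d (k n)" using s d(1)[of "k n"] by auto
        then have "L * \<bar>max 0 (s - d (k n)) - s\<bar> \<le> L * d (k n)"
          using L by (rule mult_left_mono)
        then show ?thesis
          using lip[of "max 0 (s - d (k n))" s "k n"] s d(1)[of "k n"] by auto
      qed
      then show "\<forall>\<^sub>F n in sequentially. norm (v (k n) (max 0 (s - d (k n))) - v (k n) s) \<le> L * d (k n)"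
        by simp
      show "(\<lambda>n. L * d (k n)) \<longlonglongrightarrow> 0"
        using tendsto_mult_right_zero[OF dk] by simp
    qed
    from tendsto_add[OF this pw[of s]] s have "(\<lambda>n. v (k n) (max 0 (s - d (k n)))) \<longlonglongrightarrow> u s"
      by (simp add: ug)
    moreover have "isCont G (u s)"
      using cont by (simp add: continuous_on_eq_continuous_at)
    ultimately show ?thesis
      using s unfolding w_def by (auto intro: isCont_tendsto_compose)
  qed
  have drop: "(\<lambda>n. radial_drop N (w (k n)) r) \<longlonglongrightarrow> radial_drop N (\<lambda>t. G (u (max 0 (t - 0)))) r"
    if "0 \<le> r" "r \<le> 1" for r
    by (rule tendsto_radial_drop[where c = c]) (use w N wc ww that in auto)
  have ak: "(\<lambda>n. a (k n)) \<longlonglongrightarrow> g 0"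
    using pw[of 0] v[of 0] by simp
  show ?thesis
  proof
    show "delayed_profile N G lam 0 (g 0) u"
      unfolding delayed_profile_def
    proof (intro conjI ballI u)
      fix r :: real assume r: "r \<in> {0..1}"
      have "(\<lambda>n. v (k n) r) \<longlonglongrightarrow> g 0 - lam * radial_drop N (\<lambda>t. G (u (max 0 (t - 0)))) r"
        using r by (simp add: v) (intro tendsto_intros ak, use drop[of r] in simp)
      from LIMSEQ_unique[OF pw[OF r] this] r
      show "u r = g 0 - lam * radial_drop N (\<lambda>t. G (u (max 0 (t - 0)))) r" by (simp add: ug)
    qed
    show "u 1 = 0" using LIMSEQ_unique[OF pw[of 1]] v1 by (simp add: ug)
    show "lo \<le> g 0" by (rule LIMSEQ_le_const[OF ak]) (use a in auto)
    show "g 0 \<le> hi" by (rule LIMSEQ_le_const2[OF ak]) (use a in auto)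
  qed
qed

text \<open>The factor \<open>\<sigma>\<close> lets one lemma treat both directions of the sign
  change. The sign conditions include \<open>d = 0\<close>, so they also apply to the limit
  profile.\<close>

lemma profile_between:
  assumes "lam > 0" "lo < hi"
    and sign: "\<And>d v. d \<ge> 0 \<Longrightarrow> delayed_profile N G lam d lo v \<Longrightarrow> v 1 * \<sigma> > 0"
      "\<And>d v. d \<ge> 0 \<Longrightarrow> delayed_profile N G lam d hi v \<Longrightarrow> v 1 * \<sigma> < 0"
  obtains b u where "delayed_profile N G lam 0 b u" "u 1 = 0" "lo < b" "b < hi"
proof -
  \<comment> \<open>Delay \<open>1 / (n + 1)\<close> with \<open>n + 1\<close> iterations covers
    \<open>[0, 1]\<close> exactly.\<close>
  have "\<exists>a. lo \<le> a \<and> a \<le> hi \<and> shoot N G lam (1 / real (Suc n)) (Suc n) a 1 = 0" for n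
  proof -
    let ?s = "\<lambda>a. shoot N G lam (1 / real (Suc n)) (Suc n) a 1"
    have prof: "delayed_profile N G lam (1 / real (Suc n)) a
        (shoot N G lam (1 / real (Suc n)) (Suc n) a)" for a
      by (rule delayed_profile_shoot[OF cont]) auto
    have "continuous_on UNIV (\<lambda>a. (\<lambda>(a, r). shoot N G lam (1 / real (Suc n)) (Suc n) a r) (a, 1))"
      by (rule continuous_on_compose2[OF continuous_on_shoot[OF cont]]) (auto intro!: continuous_intros)
    \<comment> \<open>The factor \<open>- \<sigma>\<close> makes the end value go from negative to
      positive, as \<open>IVT'\<close> expects.\<close>
    then have c: "continuous_on {lo..hi} (\<lambda>a. - \<sigma> * ?s a)"
      by (intro continuous_intros) (auto intro: continuous_on_subset)
    have "0 < ?s lo * \<sigma>" "?s hi * \<sigma> < 0"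
      by (rule sign(1)[OF _ prof] sign(2)[OF _ prof], simp)+
    then have "\<exists>a. lo \<le> a \<and> a \<le> hi \<and> - \<sigma> * ?s a = 0" "\<sigma> \<noteq> 0"
      using IVT'[OF _ _ _ c, of 0] assms(2) by (auto simp: mult.commute)
    then show ?thesis by auto
  qed
  then obtain a where a: "\<And>n. lo \<le> a n" "\<And>n. a n \<le> hi"
    "\<And>n. shoot N G lam (1 / real (Suc n)) (Suc n) (a n) 1 = 0" by metis
  obtain b u where b: "delayed_profile N G lam 0 b u" "u 1 = 0" "lo \<le> b" "b \<le> hi"
  proof (rule profile_limit[of lam "\<lambda>n. 1 / real (Suc n)" a
        "\<lambda>n. shoot N G lam (1 / real (Suc n)) (Suc n) (a n)" lo hi])
    show "delayed_profile N G lam (1 / real (Suc n)) (a n)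
        (shoot N G lam (1 / real (Suc n)) (Suc n) (a n))" for n
      by (rule delayed_profile_shoot[OF cont]) auto
    show "(\<lambda>n. 1 / real (Suc n)) \<longlonglongrightarrow> 0"
      by (rule LIMSEQ_Suc[OF lim_1_over_n])
  qed (use a assms in auto)
  \<comment> \<open>At \<open>lo\<close> and \<open>hi\<close> the undelayed end value is nonzero,
    whereas \<open>u 1 = 0\<close>.\<close>
  moreover have "b \<noteq> lo" "b \<noteq> hi"
    using sign[of 0 u] b by auto
  ultimately show ?thesis using that[of b u] by simp
qed

lemma two_profiles:
  assumes small: "\<And>e. e > 0 \<Longrightarrow> \<exists>a. 0 < a \<and> a < 1 \<and> (\<forall>s. 0 \<le> s \<and> s \<le> a \<longrightarrow> G s \<le> e * a ^ N)"
    and large: "\<And>e. e > 0 \<Longrightarrow> \<exists>a. 1 < a \<and> (\<forall>s. 0 \<le> s \<and> s \<le> a \<longrightarrow> G s \<le> e * a ^ N)"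
  obtains l where "l > 0"
    "\<And>lam. lam > l \<Longrightarrow> \<exists>a1 a2 v1 v2. 0 < a1 \<and> a1 < a2 \<and>
       delayed_profile N G lam 0 a1 v1 \<and> v1 1 = 0 \<and>
       delayed_profile N G lam 0 a2 v2 \<and> v2 1 = 0"
proof -
  \<comment> \<open>The minimum of \<open>G\<close> on \<open>[1/2, 1]\<close> is the constant
    \<open>m\<close> that fixes the threshold \<open>4 / root N m\<close>.\<close>
  have "\<exists>x\<in>{1/2..1}. \<forall>y\<in>{1/2..1}. G x \<le> G y"
    using cont by (intro continuous_attains_inf) (auto intro: continuous_on_subset)
  then obtain x where x: "x \<in> {1/2..1}" "\<And>y. y \<in> {1/2..1} \<Longrightarrow> G x \<le> G y" by auto
  define m where "m = G x"
  have m: "m > 0" "\<And>s. 1/2 \<le> s \<Longrightarrow> s \<le> 1 \<Longrightarrow> m \<le> G s"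
    using x pos by (auto simp: m_def)
  show ?thesis
  proof
    show l: "4 / root N m > 0" using m N by simp
    fix lam assume lam: "lam > 4 / root N m"
    then have lam0: "lam > 0" using l by linarith
    have neg: "v 1 < 0" if "d \<ge> 0" "delayed_profile N G lam d 1 v" for d v
      using profile_end_neg[OF that(2,1) m lam] .
    obtain lo where lo: "0 < lo" "lo < 1" "\<And>s. 0 \<le> s \<Longrightarrow> s \<le> lo \<Longrightarrow> G s \<le> (1 / lam) ^ N * lo ^ N"
      using small[of "(1 / lam) ^ N"] lam0 by auto
    obtain hi where hi: "1 < hi" "\<And>s. 0 \<le> s \<Longrightarrow> s \<le> hi \<Longrightarrow> G s \<le> (1 / lam) ^ N * hi ^ N"
      using large[of "(1 / lam) ^ N"] lam0 by auto
    have plo: "v 1 > 0" if "d \<ge> 0" "delayed_profile N G lam d lo v" for d v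
      using profile_end_pos[OF that(2) lam0 that(1) lo(1) lo(3)] .
    have phi: "v 1 > 0" if "d \<ge> 0" "delayed_profile N G lam d hi v" for d v
      using profile_end_pos[OF that(2) lam0 that(1) _ hi(2)] hi(1) by simp
    \<comment> \<open>The end value is positive at \<open>lo\<close>, negative at 1 and positive at
      \<open>hi\<close>, giving one zero on each side of height 1.\<close>
    obtain b1 u1 where 1: "delayed_profile N G lam 0 b1 u1" "u1 1 = 0" "lo < b1" "b1 < 1"
      using profile_between[of lam lo 1 1] lam0 lo plo neg by auto
    obtain b2 u2 where 2: "delayed_profile N G lam 0 b2 u2" "u2 1 = 0" "1 < b2" "b2 < hi"
      using profile_between[of lam 1 hi "-1"] lam0 hi phi neg by auto
    show "\<exists>a1 a2 v1 v2. 0 < a1 \<and> a1 < a2 \<and>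
       delayed_profile N G lam 0 a1 v1 \<and> v1 1 = 0 \<and>
       delayed_profile N G lam 0 a2 v2 \<and> v2 1 = 0"
      using 1 2 lo by (intro exI[of _ b1] exI[of _ b2] exI[of _ u1] exI[of _ u2]) auto
  qed
qed

section \<open>From an integral profile to a classical solution\<close>

text \<open>The integral formula extends \<open>v\<close> beyond \<open>[0, 1]\<close> to
  \<open>U\<close>, so two-sided derivatives are available. For the second derivative the mean must
  be positive up to both ends; its \<open>N\<close>-th root is then differentiated away from 0, and
  \<open>t = 0\<close> is treated separately.\<close>

lemma MO_solution_of_profile:
  assumes prof: "delayed_profile N G lam 0 a v" "v 1 = 0" and a: "a > 0" and lam: "lam > 0"
    and \<sigma>: "\<sigma> \<in> {1, -1::real}" and Gf: "\<And>s. s \<ge> 0 \<Longrightarrow> G s = (- \<sigma>) ^ N * f (- \<sigma> * s)"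
  obtains U where "MO_solution N f lam (\<lambda>r. \<sigma> * U r)" "U 0 = a"
    "\<And>r. 0 < r \<Longrightarrow> r < 1 \<Longrightarrow> U r > 0" "strictly_convex_on {0<..<1} (\<lambda>r. - U r)"
proof -
  define w where "w = (\<lambda>t. G (v (max 0 (t - 0))))"
  define U where "U = (\<lambda>r. a - lam * radial_drop N w r)"
  define p where "p = (\<lambda>t. t * root N (radial_mean N w t))"
  define q where "q = (\<lambda>t. t ^ N * radial_mean N w t)"
  \<comment> \<open>With \<open>\<rho>\<close> the root of the mean, this is
    \<open>w t / \<rho> ^ (N - 1)\<close>, the derivative of \<open>root N (q t)\<close> for
    \<open>t > 0\<close>. The form remains meaningful at \<open>t = 0\<close>.\<close>
  define p' where "p' = (\<lambda>t. w t * root N (radial_mean N w t) / radial_mean N w t)"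
  have w: "continuous_on UNIV w" "\<And>t. w t \<ge> 0"
    using prof(1) continuous_delayed[of v 0] by (auto simp: w_def delayed_profile_def nonneg)
  have Uv: "U r = v r" if "0 \<le> r" "r \<le> 1" for r
    using prof(1) that by (auto simp: U_def w_def delayed_profile_def)
  have wU: "w r = G (U r)" if "0 \<le> r" "r \<le> 1" for r
    using that Uv[OF that] by (simp add: w_def)
  have U0: "U 0 = a" by (simp add: U_def)
  have d1: "lam * radial_drop N w 1 = a"
    using Uv[of 1] prof(2) by (simp add: U_def)
  have Upos: "U r > 0" if "0 \<le> r" "r < 1" for r
  proof -
    have "lam * radial_drop N w r \<le> lam * (r * radial_drop N w 1)"
      using that lam by (intro mult_left_mono radial_drop_starlike w N) auto
    also have "\<dots> = r * a" using d1 by (simp add: mult.left_commute)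
    also have "\<dots> < 1 * a" using a that by (intro mult_strict_right_mono) auto
    finally show ?thesis by (simp add: U_def)
  qed
  have wpos: "w t > 0" if "0 \<le> t" "t < 1" for t
    using wU[of t] Upos[of t] pos[of "U t"] that by auto
  have qd: "(q has_real_derivative real N * t ^ (N - 1) * w t) (at t)" for t
    unfolding q_def by (rule DERIV_power_radial_mean[OF w(1) N])
  \<comment> \<open>At \<open>t = 1\<close> the source vanishes together with \<open>U\<close>, so
    the derivative of \<open>q\<close> is shown positive only in the open interval.\<close>
  have qmono: "q x < q y" if "0 \<le> x" "x < y" "y \<le> 1" for x y
  proof (rule DERIV_pos_imp_increasing_open[OF \<open>x < y\<close>])
    show "\<exists>z. (q has_real_derivative z) (at t) \<and> 0 < z" if "x < t" "t < y" for t
    proof (intro exI conjI)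
      show "0 < real N * t ^ (N - 1) * w t"
        using wpos[of t] N that \<open>0 \<le> x\<close> \<open>y \<le> 1\<close> by simp
    qed (rule qd)
    show "continuous_on {x..y} q"
      using qd by (meson DERIV_isCont continuous_at_imp_continuous_on)
  qed
  have pq: "p t = root N (q t)" if "t \<ge> 0" for t
    unfolding p_def q_def by (rule radial_slope_eq[OF N that])
  have pmono: "p x < p y" if "0 \<le> x" "x < y" "y \<le> 1" for x y
    using qmono[OF that] that N by (simp add: pq)
  have mpos: "radial_mean N w t > 0" if "0 \<le> t" "t \<le> 1" for t
  proof (cases "t = 0")
    case True
    then show ?thesis using radial_mean_at_0[OF N, of w] wpos[of 0] by simp
  next
    case False
    then show ?thesis using qmono[of 0 t] that N by (simp add: q_def power_0_left zero_less_mult_iff)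
  qed
  have Ud: "(U has_real_derivative - lam * p t) (at t)" for t
    unfolding U_def p_def using DERIV_radial_drop[OF w(1)] by (auto intro!: derivative_eq_intros)
  have mcont: "continuous_on UNIV (radial_mean N w)"
    by (rule continuous_on_radial_mean[OF w(1)])
  have pd: "(p has_real_derivative p' t) (at t)" if t: "0 \<le> t" "t \<le> 1" for t
  proof (cases "t = 0")
    case True
    \<comment> \<open>Since \<open>q 0 = 0\<close>, the chain rule for the root fails here when
      \<open>N \<ge> 2\<close>. The difference quotient of \<open>p\<close> is just the root of the
      mean, whose limit is \<open>root N (w 0)\<close>.\<close>
    have "isCont (\<lambda>h. root N (radial_mean N w h)) 0"
      using mcont by (intro continuous_intros) (simp add: continuous_on_eq_continuous_at)
    then have "((\<lambda>h. root N (radial_mean N w h)) \<longlongrightarrow> p' 0) (at 0)"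
      using mpos[of 0] radial_mean_at_0[OF N, of w] by (simp add: isCont_def p'_def)
    then have "((\<lambda>h. (p (0 + h) - p 0) / h) \<longlongrightarrow> p' 0) (at 0)"
      by (rule Lim_transform_eventually) (auto simp: eventually_at p_def intro!: exI[of _ 1])
    then show ?thesis using True by (simp add: DERIV_def)
  next
    case False
    define \<rho> where "\<rho> = root N (radial_mean N w t)"
    have \<rho>: "\<rho> > 0" "\<rho> ^ N = radial_mean N w t"
      using mpos[OF t] N by (auto simp: \<rho>_def real_root_pow_pos2)
    have q: "q t > 0" "root N (q t) = t * \<rho>"
      using mpos[OF t] False t pq[of t] by (auto simp: q_def p_def \<rho>_def)
    have "((\<lambda>s. root N (q s)) has_real_derivative
        inverse (real N * root N (q t) ^ (N - Suc 0)) * (real N * t ^ (N - 1) * w t)) (at t)"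
      using N q by (intro DERIV_chain2[OF DERIV_real_root qd]) auto
    moreover have "inverse (real N * root N (q t) ^ (N - Suc 0)) * (real N * t ^ (N - 1) * w t) = p' t"
    proof -
      have "\<rho> ^ N = \<rho> * \<rho> ^ (N - 1)" using N by (simp add: power_eq_if)
      moreover have "p' t = w t * \<rho> / \<rho> ^ N"
        unfolding p'_def \<rho>_def[symmetric] \<rho>(2) ..
      ultimately have "p' t = w t / \<rho> ^ (N - 1)"
        using \<rho>(1) by simp
      then show ?thesis
        using q \<rho> N False by (simp add: power_mult_distrib field_simps)
    qed
    ultimately have "((\<lambda>s. root N (q s)) has_real_derivative p' t) (at t)" by simp
    then show ?thesis
      by (rule has_field_derivative_transform_within_open[where S = "{0<..}"])
         (use t False pq in auto)
  qed
  have p'cont: "continuous_on {0..1} p'"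
    unfolding p'_def using w(1) mcont mpos
    by (intro continuous_intros) (auto intro: continuous_on_subset simp: less_le)
  have \<sigma>2: "(- \<sigma>) ^ N * (- \<sigma>) ^ N = 1"
    using \<sigma> by (auto simp flip: power_mult_distrib)
  have "MO_solution N f lam (\<lambda>r. \<sigma> * U r)"
    unfolding MO_solution_def
  proof (rule exI[of _ "\<lambda>r. - \<sigma> * lam * p r"], rule exI[of _ "\<lambda>r. - \<sigma> * lam * p' r"],
      intro conjI ballI)
    fix r :: real assume r: "r \<in> {0..1}"
    show "((\<lambda>r. \<sigma> * U r) has_real_derivative - \<sigma> * lam * p r) (at r within {0..1})"
      by (rule has_field_derivative_at_within) (use Ud in \<open>auto intro!: derivative_eq_intros\<close>)
    show "((\<lambda>r. - \<sigma> * lam * p r) has_real_derivative - \<sigma> * lam * p' r) (at r within {0..1})"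
      by (rule has_field_derivative_at_within) (use pd r in \<open>auto intro!: derivative_eq_intros\<close>)
  next
    show "continuous_on {0..1} (\<lambda>r. - \<sigma> * lam * p' r)"
      by (intro continuous_intros p'cont)
  next
    fix r :: real assume r: "r \<in> {0<..<1}"
    \<comment> \<open>This function is the \<open>N\<close>-th power of the derivative
      \<open>- \<sigma> * lam * p t\<close>. The sign in \<open>G\<close> cancels the sign here
      because \<open>(- \<sigma>) ^ N\<close> is its own inverse.\<close>
    have "((\<lambda>t. (- \<sigma>) ^ N * lam ^ N * q t) has_real_derivative
        (- \<sigma>) ^ N * lam ^ N * (real N * r ^ (N - 1) * w r)) (at r)"
      by (rule DERIV_cmult[OF qd])
    moreover have "w r = (- \<sigma>) ^ N * f (- (\<sigma> * U r))"
      using r wU[of r] Upos[of r] Gf[of "U r"] by simp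
    ultimately have "((\<lambda>t. (- \<sigma>) ^ N * lam ^ N * q t) has_real_derivative
        ((- \<sigma>) ^ N * (- \<sigma>) ^ N) * (lam ^ N * real N * r ^ (N - 1) * f (- (\<sigma> * U r)))) (at r)"
      by (simp only: mult_ac)
    then have "((\<lambda>t. (- \<sigma>) ^ N * lam ^ N * q t) has_real_derivative
        lam ^ N * real N * r ^ (N - 1) * f (- (\<sigma> * U r))) (at r)"
      by (simp only: \<sigma>2 mult_1)
    then show "((\<lambda>t. (- \<sigma> * lam * p t) ^ N) has_real_derivative
        lam ^ N * real N * r ^ (N - 1) * f (- (\<sigma> * U r))) (at r)"
    proof (rule has_field_derivative_transform_within_open[where S = "{0<..<1}"])
      fix t :: real assume t: "t \<in> {0<..<1}"
      have "p t ^ N = q t"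
        using t mpos[of t] N by (simp add: p_def q_def power_mult_distrib real_root_pow_pos2)
      then show "(- \<sigma>) ^ N * lam ^ N * q t = (- \<sigma> * lam * p t) ^ N"
        by (simp only: power_mult_distrib)
    qed (use r in auto)
  next
    show "- \<sigma> * lam * p 0 = 0" by (simp add: p_def)
    show "\<sigma> * U 1 = 0" using Uv[of 1] prof(2) by simp
  qed
  moreover have "strictly_convex_on {0<..<1} (\<lambda>r. - U r)"
  proof (rule strictly_convex_on_deriv[where g' = "\<lambda>r. lam * p r"])
    show "((\<lambda>r. - U r) has_real_derivative lam * p x) (at x)" for x
      using Ud by (auto intro!: derivative_eq_intros)
    show "lam * p x < lam * p y" if "0 < x" "x < y" "y < 1" for x y
      using pmono[of x y] that lam by simp
  qed
  ultimately show ?thesis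
    using that[of U] U0 Upos by simp
qed

end

section \<open>Reduction of the equation to a positive nonlinearity, for both signs\<close>

lemma two_MO_solutions:
  fixes N :: nat and f :: "real \<Rightarrow> real" and \<sigma> :: real
  assumes N: "N \<ge> 1"
    and cont: "continuous_on UNIV f"
    and sgn: "\<And>s. s \<noteq> 0 \<Longrightarrow> f s * s ^ N > 0"
    and lim0: "((\<lambda>s. f s / s ^ N) \<longlongrightarrow> 0) (at 0)"
    and liminf: "((\<lambda>s. f s / s ^ N) \<longlongrightarrow> 0) at_infinity"
    and \<sigma>: "\<sigma> \<in> {1, -1}"
  obtains l where "l > 0" "\<And>lam. lam > l \<Longrightarrow> \<exists>U1 U2.
     MO_solution N f lam (\<lambda>r. \<sigma> * U1 r) \<and> MO_solution N f lam (\<lambda>r. \<sigma> * U2 r) \<and>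
     U1 0 \<noteq> U2 0 \<and> (\<forall>r\<in>{0<..<1}. U1 r > 0 \<and> U2 r > 0) \<and>
     strictly_convex_on {0<..<1} (\<lambda>r. - U1 r) \<and> strictly_convex_on {0<..<1} (\<lambda>r. - U2 r)"
proof -
  \<comment> \<open>For \<open>s > 0\<close> the sign condition at \<open>- \<sigma> * s\<close>
    gives \<open>G s > 0\<close>; cutting off with \<open>max 0\<close> and using
    \<open>f 0 = 0\<close> gives the zero extension.\<close>
  define G where "G = (\<lambda>s. (- \<sigma>) ^ N * f (- \<sigma> * max 0 s))"
  have \<sigma>2: "(- \<sigma>) ^ N * (- \<sigma>) ^ N = 1"
    using \<sigma> by (auto simp flip: power_mult_distrib)
  \<comment> \<open>Near 0, \<open>f s\<close> is the quotient times \<open>s ^ N\<close>, and both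
    factors tend to 0.\<close>
  have f0: "f 0 = 0"
  proof -
    have "((\<lambda>s. f s / s ^ N * s ^ N) \<longlongrightarrow> 0 * 0 ^ N) (at 0)"
      by (intro tendsto_intros lim0)
    then have "((\<lambda>s. f s / s ^ N * s ^ N) \<longlongrightarrow> 0) (at 0)" by simp
    then have "(f \<longlongrightarrow> 0) (at 0)"
      by (rule Lim_transform_eventually) (auto simp: eventually_at intro!: exI[of _ 1])
    moreover have "(f \<longlongrightarrow> f 0) (at 0)"
      using cont by (simp add: continuous_on_eq_continuous_at isCont_def)
    ultimately show ?thesis using LIM_unique by blast
  qed
  have Gq: "G s = f (- \<sigma> * s) / (- \<sigma> * s) ^ N * s ^ N" if "s > 0" for s
  proof -
    have "f (- \<sigma> * s) / (- \<sigma> * s) ^ N * s ^ N = f (- \<sigma> * s) / (- \<sigma>) ^ N"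
      using that by (simp only: power_mult_distrib) simp
    also have "\<dots> = (- \<sigma>) ^ N * f (- \<sigma> * s)"
      by (simp only: divide_inverse inverse_unique[OF \<sigma>2] mult.commute)
    finally show ?thesis using that by (simp add: G_def max_def)
  qed
  interpret positive_nonlinearity N G
  proof
    show "continuous_on UNIV G"
      unfolding G_def
      by (intro continuous_intros continuous_on_compose2[OF cont]) auto
    show "G s = 0" if "s \<le> 0" for s
      using that f0 by (simp add: G_def max_def)
    show "G s > 0" if "s > 0" for s
    proof -
      have "f (- \<sigma> * s) * (- \<sigma> * s) ^ N > 0"
        using sgn[of "- \<sigma> * s"] \<sigma> that by auto
      then have "f (- \<sigma> * s) / (- \<sigma> * s) ^ N > 0"
        by (simp add: zero_less_mult_iff zero_less_divide_iff)
      then have "f (- \<sigma> * s) / (- \<sigma> * s) ^ N * s ^ N > 0"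
        using that by (intro mult_pos_pos) auto
      then show ?thesis by (simp only: Gq[OF that])
    qed
  qed (rule N)
  \<comment> \<open>A small quotient at the single point \<open>- \<sigma> * s\<close> suffices,
    since \<open>s ^ N \<le> a ^ N\<close>.\<close>
  have Gle: "G s \<le> e * a ^ N"
    if "0 \<le> s" "s \<le> a" "e > 0" "s > 0 \<Longrightarrow> norm (f (- \<sigma> * s) / (- \<sigma> * s) ^ N) < e" for s a e
  proof (cases "s = 0")
    case True
    then show ?thesis using nonpos[of 0] that by simp
  next
    case False
    then have "s > 0" using that by simp
    have "f (- \<sigma> * s) / (- \<sigma> * s) ^ N \<le> e"
      using that(4)[OF \<open>s > 0\<close>] unfolding real_norm_def by linarith
    then have "f (- \<sigma> * s) / (- \<sigma> * s) ^ N * s ^ N \<le> e * a ^ N"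
      using that(1-3) by (intro mult_mono power_mono) auto
    then show ?thesis using Gq[OF \<open>s > 0\<close>] by simp
  qed
  have n\<sigma>: "norm (- \<sigma> * s) = \<bar>s\<bar>" for s using \<sigma> by (auto simp: abs_mult)
  have small: "\<exists>a. 0 < a \<and> a < 1 \<and> (\<forall>s. 0 \<le> s \<and> s \<le> a \<longrightarrow> G s \<le> e * a ^ N)" if "e > 0" for e
  proof -
    obtain d where d: "d > 0" "\<And>x. x \<noteq> 0 \<Longrightarrow> norm x < d \<Longrightarrow> norm (f x / x ^ N) < e"
      using LIM_D[OF lim0 \<open>e > 0\<close>] by auto
    \<comment> \<open>\<open>d/2\<close> stays strictly inside the radius where the quotient is
      small, and \<open>1/2\<close> keeps the height below 1.\<close>
    have "G s \<le> e * (min (d/2) (1/2)) ^ N" if "0 \<le> s" "s \<le> min (d/2) (1/2)" for s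
    proof (rule Gle)
      show "norm (f (- \<sigma> * s) / (- \<sigma> * s) ^ N) < e" if "s > 0"
        using that \<open>s \<le> _\<close> n\<sigma>[of s] \<sigma> d(1) by (intro d(2)) auto
    qed (use that \<open>e > 0\<close> in auto)
    then show ?thesis using d(1) by (intro exI[of _ "min (d/2) (1/2)"]) auto
  qed
  have large: "\<exists>a. 1 < a \<and> (\<forall>s. 0 \<le> s \<and> s \<le> a \<longrightarrow> G s \<le> e * a ^ N)" if "e > 0" for e
  proof -
    have "\<forall>\<^sub>F x in at_infinity. norm (f x / x ^ N) < e"
      using tendstoD[OF liminf that] by (simp add: dist_norm)
    then obtain R where R: "\<And>x. norm x \<ge> R \<Longrightarrow> norm (f x / x ^ N) < e"
      by (auto simp: eventually_at_infinity)
    have "compact (G ` {0..R})"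
      using positive_nonlinearity.cont[OF positive_nonlinearity_axioms]
      by (intro compact_continuous_image) (auto intro: continuous_on_subset)
    then obtain M where M: "\<And>x. x \<in> G ` {0..R} \<Longrightarrow> norm x \<le> M"
      using bounded_iff compact_imp_bounded by metis
    \<comment> \<open>For \<open>s \<le> R\<close> the chain
      \<open>G s \<le> M \<le> e * a \<le> e * a ^ N\<close> works because \<open>a > 1\<close>;
      beyond \<open>R\<close> the quotient is small.\<close>
    define a where "a = max 2 (M / e)"
    have a: "1 < a" "M \<le> e * a"
      using that by (auto simp: a_def field_simps max_def)
    have "G s \<le> e * a ^ N" if "0 \<le> s" "s \<le> a" for s
    proof (cases "s \<le> R")
      case True
      then have "G s \<le> M" using M[of "G s"] that by auto
      also have "\<dots> \<le> e * a" by (rule a)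
      also have "\<dots> \<le> e * a ^ N"
        using a(1) N \<open>e > 0\<close> by (intro mult_left_mono self_le_power) auto
      finally show ?thesis .
    next
      case False
      then show ?thesis
        using that \<open>e > 0\<close> n\<sigma>[of s] by (intro Gle R) auto
    qed
    then show ?thesis using a(1) by blast
  qed
  obtain l where l: "l > 0" "\<And>lam. lam > l \<Longrightarrow> \<exists>a1 a2 v1 v2. 0 < a1 \<and> a1 < a2 \<and>
       delayed_profile N G lam 0 a1 v1 \<and> v1 1 = 0 \<and>
       delayed_profile N G lam 0 a2 v2 \<and> v2 1 = 0"
    using two_profiles[OF small large] by blast
  show ?thesis
  proof (rule that[OF l(1)])
    fix lam assume lam: "lam > l"
    then have lam0: "lam > 0" using l(1) by simp
    obtain a1 a2 v1 v2 where v: "0 < a1" "a1 < a2"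
      "delayed_profile N G lam 0 a1 v1" "v1 1 = 0" "delayed_profile N G lam 0 a2 v2" "v2 1 = 0"
      using l(2)[OF lam] by blast
    have Gf: "G s = (- \<sigma>) ^ N * f (- \<sigma> * s)" if "s \<ge> 0" for s
      using that by (simp add: G_def max_def)
    obtain U1 where U1: "MO_solution N f lam (\<lambda>r. \<sigma> * U1 r)" "U1 0 = a1"
      "\<And>r. 0 < r \<Longrightarrow> r < 1 \<Longrightarrow> U1 r > 0" "strictly_convex_on {0<..<1} (\<lambda>r. - U1 r)"
      using MO_solution_of_profile[OF v(3,4,1) lam0 \<sigma> Gf] by blast
    obtain U2 where U2: "MO_solution N f lam (\<lambda>r. \<sigma> * U2 r)" "U2 0 = a2"
      "\<And>r. 0 < r \<Longrightarrow> r < 1 \<Longrightarrow> U2 r > 0" "strictly_convex_on {0<..<1} (\<lambda>r. - U2 r)"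
      using MO_solution_of_profile[OF v(5,6) less_trans[OF v(1,2)] lam0 \<sigma> Gf] by blast
    show "\<exists>U1 U2.
     MO_solution N f lam (\<lambda>r. \<sigma> * U1 r) \<and> MO_solution N f lam (\<lambda>r. \<sigma> * U2 r) \<and>
     U1 0 \<noteq> U2 0 \<and> (\<forall>r\<in>{0<..<1}. U1 r > 0 \<and> U2 r > 0) \<and>
     strictly_convex_on {0<..<1} (\<lambda>r. - U1 r) \<and> strictly_convex_on {0<..<1} (\<lambda>r. - U2 r)"
      using U1 U2 v(2) by (intro exI[of _ U1] exI[of _ U2]) auto
  qed
qed

theorem theorem4p5:
  fixes N :: nat and f :: "real \<Rightarrow> real"
  assumes "N \<ge> 1"
    and "continuous_on UNIV f"
    and "\<And>s. s \<noteq> 0 \<Longrightarrow> f s * s ^ N > 0"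
    and "((\<lambda>s. f s / s ^ N) \<longlongrightarrow> 0) (at 0)"
    and "((\<lambda>s. f s / s ^ N) \<longlongrightarrow> 0) at_infinity"
  shows "(\<exists>lp > 0. \<forall>lam > lp. \<exists>u1 u2.
            MO_solution N f lam u1 \<and> MO_solution N f lam u2 \<and>
            (\<exists>r\<in>{0..1}. u1 r \<noteq> u2 r) \<and>
            (\<forall>r\<in>{0<..<1}. u1 r > 0 \<and> u2 r > 0) \<and>
            strictly_concave_on {0<..<1} u1 \<and> strictly_concave_on {0<..<1} u2)
       \<and> (\<exists>lm > 0. \<forall>lam > lm. \<exists>u1 u2.
            MO_solution N f lam u1 \<and> MO_solution N f lam u2 \<and>
            (\<exists>r\<in>{0..1}. u1 r \<noteq> u2 r) \<and>
            (\<forall>r\<in>{0<..<1}. u1 r < 0 \<and> u2 r < 0) \<and>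
            strictly_convex_on {0<..<1} u1 \<and> strictly_convex_on {0<..<1} u2)"
proof
  obtain l where l: "l > 0" "\<And>lam. lam > l \<Longrightarrow> \<exists>U1 U2.
     MO_solution N f lam (\<lambda>r. 1 * U1 r) \<and> MO_solution N f lam (\<lambda>r. 1 * U2 r) \<and>
     U1 0 \<noteq> U2 0 \<and> (\<forall>r\<in>{0<..<1}. U1 r > 0 \<and> U2 r > 0) \<and>
     strictly_convex_on {0<..<1} (\<lambda>r. - U1 r) \<and> strictly_convex_on {0<..<1} (\<lambda>r. - U2 r)"
    using two_MO_solutions[OF assms, of 1] by blast
  show "\<exists>lp > 0. \<forall>lam > lp. \<exists>u1 u2.
            MO_solution N f lam u1 \<and> MO_solution N f lam u2 \<and>
            (\<exists>r\<in>{0..1}. u1 r \<noteq> u2 r) \<and>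
            (\<forall>r\<in>{0<..<1}. u1 r > 0 \<and> u2 r > 0) \<and>
            strictly_concave_on {0<..<1} u1 \<and> strictly_concave_on {0<..<1} u2"
  proof (intro exI[of _ l] conjI allI impI l(1))
    fix lam assume "lam > l"
    then obtain U1 U2 where "MO_solution N f lam U1" "MO_solution N f lam U2" "U1 0 \<noteq> U2 0"
      "\<forall>r\<in>{0<..<1}. U1 r > 0 \<and> U2 r > 0"
      "strictly_convex_on {0<..<1} (\<lambda>r. - U1 r)" "strictly_convex_on {0<..<1} (\<lambda>r. - U2 r)"
      using l(2)[of lam] by auto
    then show "\<exists>u1 u2.
            MO_solution N f lam u1 \<and> MO_solution N f lam u2 \<and>
            (\<exists>r\<in>{0..1}. u1 r \<noteq> u2 r) \<and>
            (\<forall>r\<in>{0<..<1}. u1 r > 0 \<and> u2 r > 0) \<and>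
            strictly_concave_on {0<..<1} u1 \<and> strictly_concave_on {0<..<1} u2"
      \<comment> \<open>The two solutions differ at \<open>r = 0\<close>, where they take their
        distinct heights.\<close>
      unfolding strictly_concave_on_def
      by (intro exI[of _ U1] exI[of _ U2] conjI bexI[of _ 0]) auto
  qed
  \<comment> \<open>For \<open>\<sigma> = -1\<close> the solutions are \<open>- U1\<close> and
    \<open>- U2\<close>, whose strict convexity is exactly what the lemma provides.\<close>
  obtain l where l: "l > 0" "\<And>lam. lam > l \<Longrightarrow> \<exists>U1 U2.
     MO_solution N f lam (\<lambda>r. - 1 * U1 r) \<and> MO_solution N f lam (\<lambda>r. - 1 * U2 r) \<and>
     U1 0 \<noteq> U2 0 \<and> (\<forall>r\<in>{0<..<1}. U1 r > 0 \<and> U2 r > 0) \<and>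
     strictly_convex_on {0<..<1} (\<lambda>r. - U1 r) \<and> strictly_convex_on {0<..<1} (\<lambda>r. - U2 r)"
    using two_MO_solutions[OF assms, of "-1"] by blast
  show "\<exists>lm > 0. \<forall>lam > lm. \<exists>u1 u2.
            MO_solution N f lam u1 \<and> MO_solution N f lam u2 \<and>
            (\<exists>r\<in>{0..1}. u1 r \<noteq> u2 r) \<and>
            (\<forall>r\<in>{0<..<1}. u1 r < 0 \<and> u2 r < 0) \<and>
            strictly_convex_on {0<..<1} u1 \<and> strictly_convex_on {0<..<1} u2"
  proof (intro exI[of _ l] conjI allI impI l(1))
    fix lam assume "lam > l"
    then obtain U1 U2 where "MO_solution N f lam (\<lambda>r. - U1 r)" "MO_solution N f lam (\<lambda>r. - U2 r)"
      "U1 0 \<noteq> U2 0" "\<forall>r\<in>{0<..<1}. U1 r > 0 \<and> U2 r > 0"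
      "strictly_convex_on {0<..<1} (\<lambda>r. - U1 r)" "strictly_convex_on {0<..<1} (\<lambda>r. - U2 r)"
      using l(2)[of lam] by auto
    then show "\<exists>u1 u2.
            MO_solution N f lam u1 \<and> MO_solution N f lam u2 \<and>
            (\<exists>r\<in>{0..1}. u1 r \<noteq> u2 r) \<and>
            (\<forall>r\<in>{0<..<1}. u1 r < 0 \<and> u2 r < 0) \<and>
            strictly_convex_on {0<..<1} u1 \<and> strictly_convex_on {0<..<1} u2"
      by (intro exI[of _ "\<lambda>r. - U1 r"] exI[of _ "\<lambda>r. - U2 r"] conjI bexI[of _ 0]) auto
  qed
qed

end
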